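(* Let $X$ and $Y$ be locally compact Hausdorff spaces and let $\mathbf{F}\subset\mathcal{C}(X)$ be a $2$-independent linear subspace. Let $\omega:Y\to\mathbb{F}$ and $\Phi:Y\to X$ be arbitrary (not necessarily continuous) maps such that $W_{\Phi,\omega}\mathbf{F}\subset\mathcal{C}(Y)$. Then: (i) If $X$ is compact, then $\omega$ is continuous and $\Phi$ is continuous outside of $\omega^{-1}(0)$. (ii) If $\mathbf{F}\subset\mathcal{C}_{0}(X)$ and $\omega$ is bounded, then $\omega$ and $\Phi$ are continuous outside of $\omega^{-1}(0)$.
   Context: $\mathbb{F}$ is $\mathbb{R}$ or $\mathbb{C}$. $\mathcal{C}(X)$ is the space of continuous $\mathbb{F}$-valued functions on $X$. $\mathcal{C}_0(X)$ is the set of $f\in\mathcal{C}(X)$ such that for every $\varepsilon>0$ there is a compact $K\subset X$ with $|f(x)|<\varepsilon$ for $x\notin K$ (so $\mathcal{C}_0(X)=\mathcal{C}(X)$ if $X$ is compact). For maps $\Phi:Y\to X$, $\omega:Y\to\mathbb{F}$ and $f:X\to\mathbb{F}$, $[W_{\Phi,\omega}f](y)=\omega(y)f(\Phi(y))$. For $x\in X$, $x_{\mathbf{F}}:\mathbf{F}\to\mathbb{F}$ is the point evaluation $x_{\mathbf{F}}(f)=f(x)$. $\mathbf{F}$ is $2$-independent if $x_{\mathbf{F}}\neq 0$ for every $x\in X$, and $x_{\mathbf{F}}$ and $y_{\mathbf{F}}$ are linearly independent for every distinct $x,y\in X$ (the first condition is automatic if $X$ has at least two points). "Continuous outside of $\omega^{-1}(0)$"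 means that the restriction to $Y\setminus\omega^{-1}(0)$ is continuous. *)

theory Defs
  imports "HOL-Analysis.Analysis" "HOL-Library.Function_Algebras"
begin

text \<open>
  The scalar field is a type of class \<^class>\<open>real_normed_field\<close>. Both \<^typ>\<open>real\<close> and \<^typ>\<open>complex\<close>
  are instances and, by the Gelfand--Mazur theorem, every instance is isometrically
  isomorphic to one of the two.

  Spaces are abstract topologies. A function on \<open>X\<close> is a function on the underlying type; its values
  outside \<^term>\<open>topspace X\<close> are irrelevant.
\<close>

definition fun_scale :: "'k \<Rightarrow> ('a \<Rightarrow> 'k) \<Rightarrow> 'a \<Rightarrow> 'k::field"
  where "fun_scale c f = (\<lambda>x. c * f x)"

global_interpretation fun_space: vector_space "fun_scale :: 'k \<Rightarrow> ('a \<Rightarrow> 'k) \<Rightarrow> 'a \<Rightarrow> 'k::field"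
  by unfold_locales (auto simp: fun_scale_def fun_eq_iff algebra_simps)

definition cont_funs :: "'a topology \<Rightarrow> ('a \<Rightarrow> 'k::real_normed_field) set"
  where "cont_funs X = {f. continuous_map X euclidean f}"

definition cont_funs_0 :: "'a topology \<Rightarrow> ('a \<Rightarrow> 'k::real_normed_field) set"
  where "cont_funs_0 X =
    {f \<in> cont_funs X. \<forall>\<epsilon>>0. \<exists>K. compactin X K \<and> (\<forall>x \<in> topspace X - K. norm (f x) < \<epsilon>)}"

definition weighted_comp :: "('b \<Rightarrow> 'a) \<Rightarrow> ('b \<Rightarrow> 'k) \<Rightarrow> ('a \<Rightarrow> 'k) \<Rightarrow> 'b \<Rightarrow> 'k::real_normed_field"
  where "weighted_comp \<Phi> \<omega> f = (\<lambda>y. \<omega> y * f (\<Phi> y))"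

text \<open>
  A functional on \<open>F\<close> is represented by its extension by zero outside \<open>F\<close>, so that equality,
  vanishing and linear independence of such functions are those of the functionals on \<open>F\<close>.
\<close>

definition point_eval :: "('a \<Rightarrow> 'k) set \<Rightarrow> 'a \<Rightarrow> ('a \<Rightarrow> 'k) \<Rightarrow> 'k::real_normed_field"
  where "point_eval F x = (\<lambda>f. if f \<in> F then f x else 0)"

text \<open>
  Independence in the library is a property of sets; for the pair of evaluations at \<open>x\<close> and \<open>y\<close> one
  has to require in addition that the two are different.
\<close>

definition two_independent :: "'a topology \<Rightarrow> ('a \<Rightarrow> 'k::real_normed_field) set \<Rightarrow> bool"
  where "two_independent X F \<longleftrightarrow>
    (\<forall>x \<in> topspace X. point_eval F x \<noteq> 0) \<and>
    (\<forall>x \<in> topspace X. \<forall>y \<in> topspace X. x \<noteq> y \<longrightarrow>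
       point_eval F x \<noteq> point_eval F y \<and>
       fun_space.independent {point_eval F x, point_eval F y})"

end

theory Submission
  imports Defs
begin

text \<open>
  Fix \<open>y\<^sub>0\<close> with \<open>\<omega> y\<^sub>0 \<noteq> 0\<close>, put \<open>x\<^sub>0 = \<Phi> y\<^sub>0\<close>, and let \<open>x \<noteq> x\<^sub>0\<close>. Independence of the two evaluations
  gives \<open>f, g \<in> F\<close> with \<open>f x = 0 \<noteq> f x\<^sub>0\<close> and \<open>g x\<^sub>0 = 0 \<noteq> g x\<close>. The set where \<open>|f| < |g|\<close> is a neighbourhood
  of \<open>x\<close>, the set where \<open>|\<omega> (g \<circ> \<Phi>)| < |\<omega> (f \<circ> \<Phi>)|\<close> is a neighbourhood of \<open>y\<^sub>0\<close>, and \<open>\<Phi>\<close> maps no point of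
  the latter into the former. A finite cover then shows that \<open>\<Phi>\<close> avoids, near \<open>y\<^sub>0\<close>, any compact
  set not containing \<open>x\<^sub>0\<close>, so \<open>\<Phi>\<close> is continuous at \<open>y\<^sub>0\<close> as soon as it maps a neighbourhood of \<open>y\<^sub>0\<close> into
  a compact set. This is trivial if \<open>X\<close> is compact; if \<open>\<omega>\<close> is bounded and \<open>F\<close> consists of functions
  vanishing at infinity, it holds because \<open>\<omega> (f \<circ> \<Phi>)\<close> is bounded away from zero near \<open>y\<^sub>0\<close> for some
  \<open>f \<in> F\<close>. Dividing \<open>\<omega> (f \<circ> \<Phi>)\<close> by \<open>f \<circ> \<Phi>\<close> gives the continuity of \<open>\<omega>\<close> at \<open>y\<^sub>0\<close>.
  At a zero of \<open>\<omega>\<close> and for compact \<open>X\<close>, finitely many \<open>f \<in> F\<close> have no common zero, so \<open>\<omega>\<close> is small where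
  all the functions \<open>\<omega> (f \<circ> \<Phi>)\<close> are small.
\<close>

lemma two_independent_nonzero:
  assumes "two_independent X F" "x \<in> topspace X"
  obtains f where "f \<in> F" "f x \<noteq> 0"
proof -
  have "point_eval F x \<noteq> 0"
    using assms by (auto simp: two_independent_def)
  then show thesis
    using that by (auto simp: point_eval_def fun_eq_iff split: if_splits)
qed

text \<open>If every member of \<open>F\<close> vanishing at \<open>x\<close> also vanished at
  \<open>y\<close>, the evaluation at \<open>y\<close> would be a multiple of the one at
  \<open>x\<close>.\<close>

lemma two_independent_separates:
  assumes ind: "two_independent X F" and F: "fun_space.subspace F"
    and x: "x \<in> topspace X" and y: "y \<in> topspace X" and "x \<noteq> y"
  obtains f where "f \<in> F" "f x = 0" "f y \<noteq> 0"
proof (rule ccontr)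
  assume "\<not> thesis"
  then have zero: "f y = 0" if "f \<in> F" "f x = 0" for f
    using that \<open>\<And>f. f \<in> F \<Longrightarrow> f x = 0 \<Longrightarrow> f y \<noteq> 0 \<Longrightarrow> thesis\<close> by blast
  obtain h where h: "h \<in> F" "h x \<noteq> 0"
    using two_independent_nonzero[OF ind x] .
  have "f y = h y / h x * f x" if f: "f \<in> F" for f
  proof -
    \<comment> \<open>The coefficient is chosen so that the difference vanishes at
      \<open>x\<close>.\<close>
    have "f - fun_scale (f x / h x) h \<in> F"
      by (intro fun_space.subspace_diff fun_space.subspace_scale F f h)
    from zero[OF this] h(2) show ?thesis
      by (simp add: fun_scale_def)
  qed
  then have "point_eval F y = fun_scale (h y / h x) (point_eval F x)"
    by (auto simp: point_eval_def fun_scale_def fun_eq_iff)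
  then have "point_eval F y \<in> fun_space.span {point_eval F x}"
    by (simp add: fun_space.span_base fun_space.span_scale)
  \<comment> \<open>Since the evaluations differ, removing the one at \<open>y\<close> from the pair
    leaves exactly the one at \<open>x\<close>.\<close>
  moreover have "point_eval F x \<noteq> point_eval F y"
    and "fun_space.independent {point_eval F x, point_eval F y}"
    using ind x y \<open>x \<noteq> y\<close> by (auto simp: two_independent_def)
  then have "point_eval F y \<notin> fun_space.span {point_eval F x}"
    unfolding fun_space.dependent_def by (auto simp: insert_Diff_if)
  ultimately show False
    by blast
qed

lemma compactin_local_property:
  assumes K: "compactin X K" and y: "y \<in> topspace Y"
    and loc: "\<And>x. x \<in> K \<Longrightarrow> \<exists>U V. openin X U \<and> x \<in> U \<and> openin Y V \<and> y \<in> V \<and>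
                (\<forall>z \<in> V. \<Phi> z \<in> U \<longrightarrow> P z)"
  obtains V where "openin Y V" "y \<in> V" "\<And>z. z \<in> V \<Longrightarrow> \<Phi> z \<in> K \<Longrightarrow> P z"
proof -
  obtain U V where UV: "openin X (U x) \<and> x \<in> U x \<and> openin Y (V x) \<and> y \<in> V x \<and>
      (\<forall>z \<in> V x. \<Phi> z \<in> U x \<longrightarrow> P z)" if "x \<in> K" for x
    using loc by metis
  have "(\<forall>A \<in> U ` K. openin X A) \<and> K \<subseteq> \<Union> (U ` K)"
    using UV by blast
  then obtain \<F> where "finite \<F>" "\<F> \<subseteq> U ` K" "K \<subseteq> \<Union> \<F>"
    using K unfolding compactin_def by meson
  then obtain C where C: "C \<subseteq> K" "finite C" "K \<subseteq> \<Union> (U ` C)"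
    by (metis finite_subset_image)
  \<comment> \<open>The factor \<open>topspace Y\<close> covers the case of empty \<open>C\<close>,
    where the intersection is \<open>UNIV\<close>.\<close>
  have "openin Y (topspace Y \<inter> \<Inter> (V ` C))"
    using C UV by (cases "C = {}") (auto intro!: openin_Int openin_Inter)
  then show thesis
    by (rule that) (use C UV y in blast)+
qed

text \<open>A limit along all of \<open>Y\<close> restricts to \<open>S\<close>, because the
  punctured neighbourhood filter within \<open>S\<close> is finer.\<close>

lemma continuous_map_subtopology_limitin:
  assumes "\<And>x. x \<in> S \<Longrightarrow> limitin Z h (h x) (atin Y x)"
  shows "continuous_map (subtopology Y S) Z h"
proof -
  have "atin_within Y x S \<le> atin Y x" for x
    by (auto simp: le_filter_def eventually_atin_within)
  then have "limitin Z h (h x) (atin (subtopology Y S) x)" if "x \<in> S" for x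
    using assms[OF that] that by (auto simp: atin_subtopology_within limitin_def le_filter_def)
  then show ?thesis
    by (auto simp: continuous_map_atin)
qed

lemma openin_norm_less:
  fixes f g :: "'a \<Rightarrow> 'k::real_normed_vector"
  assumes "continuous_map X euclidean f" "continuous_map X euclidean g"
  shows "openin X {x \<in> topspace X. norm (f x) < norm (g x)}"
proof -
  have "continuous_map X euclideanreal (\<lambda>x. norm (g x) - norm (f x))"
    using assms by (intro continuous_intros)
  from openin_continuous_map_preimage[OF this, of "{0<..}"] show ?thesis
    by simp
qed

context
  fixes X :: "'a topology" and Y :: "'b topology"
    and F :: "('a \<Rightarrow> 'k::real_normed_field) set"
    and \<omega> :: "'b \<Rightarrow> 'k" and \<Phi> :: "'b \<Rightarrow> 'a"
  assumes F: "fun_space.subspace F" "F \<subseteq> cont_funs X"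
    and ind: "two_independent X F"
    and \<Phi>: "\<Phi> \<in> topspace Y \<rightarrow> topspace X"
    and W: "weighted_comp \<Phi> \<omega> ` F \<subseteq> cont_funs Y"
begin

lemma continuous_map_member:
  assumes "f \<in> F"
  shows "continuous_map X euclidean f"
  using assms F by (auto simp: cont_funs_def)

lemma continuous_map_weighted:
  assumes "f \<in> F"
  shows "continuous_map Y euclidean (\<lambda>y. \<omega> y * f (\<Phi> y))"
  using assms W by (auto simp: cont_funs_def weighted_comp_def)

lemma avoids_compact_near:
  assumes y: "y \<in> topspace Y" and nz: "\<omega> y \<noteq> 0"
    and K: "compactin X K" and "\<Phi> y \<notin> K"
  obtains V where "openin Y V" "y \<in> V" "\<And>z. z \<in> V \<Longrightarrow> \<Phi> z \<notin> K"
proof -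
  have \<Phi>y: "\<Phi> y \<in> topspace X"
    using \<Phi> y by auto
  have "\<exists>U V. openin X U \<and> x \<in> U \<and> openin Y V \<and> y \<in> V \<and> (\<forall>z \<in> V. \<Phi> z \<in> U \<longrightarrow> False)"
    if "x \<in> K" for x
  proof -
    have x: "x \<in> topspace X" "x \<noteq> \<Phi> y"
      using K that \<open>\<Phi> y \<notin> K\<close> compactin_subset_topspace by auto
    obtain f where f: "f \<in> F" "f x = 0" "f (\<Phi> y) \<noteq> 0"
      using two_independent_separates[OF ind F(1) x(1) \<Phi>y x(2)] .
    obtain g where g: "g \<in> F" "g (\<Phi> y) = 0" "g x \<noteq> 0"
      using two_independent_separates[OF ind F(1) \<Phi>y x(1) x(2)[symmetric]] .
    let ?U = "{x \<in> topspace X. norm (f x) < norm (g x)}"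
    let ?V = "{z \<in> topspace Y. norm (\<omega> z * g (\<Phi> z)) < norm (\<omega> z * f (\<Phi> z))}"
    have "openin X ?U" "openin Y ?V"
      using f g by (auto intro: openin_norm_less continuous_map_member continuous_map_weighted)
    moreover have "x \<in> ?U" "y \<in> ?V"
      using f g x y nz by auto
    \<comment> \<open>Cancelling \<open>norm (\<omega> z)\<close> in the inequality of
      \<open>?V\<close> reverses the inequality of \<open>?U\<close> at
      \<open>\<Phi> z\<close>.\<close>
    moreover have "\<Phi> z \<notin> ?U" if "z \<in> ?V" for z
      using that by (auto simp: norm_mult mult_less_cancel_left)
    ultimately show ?thesis
      by blast
  qed
  then show thesis
    using that by (rule compactin_local_property[OF K y]) auto
qed

lemma limitin_composition_map:
  assumes y: "y \<in> topspace Y" and nz: "\<omega> y \<noteq> 0"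
    and K: "compactin X K" and V: "openin Y V" "y \<in> V" "\<And>z. z \<in> V \<Longrightarrow> \<Phi> z \<in> K"
  shows "limitin X \<Phi> (\<Phi> y) (atin Y y)"
  unfolding limitin_def
proof (intro conjI allI impI)
  show "\<Phi> y \<in> topspace X"
    using \<Phi> y by auto
  fix U assume U: "openin X U \<and> \<Phi> y \<in> U"
  \<comment> \<open>The part of \<open>K\<close> outside \<open>U\<close> is a compact set missing
    \<open>\<Phi> y\<close>.\<close>
  have "compactin X (K \<inter> (topspace X - U))"
    using K U by (intro compact_Int_closedin) auto
  then obtain V' where V': "openin Y V'" "y \<in> V'" "\<And>z. z \<in> V' \<Longrightarrow> \<Phi> z \<notin> K \<inter> (topspace X - U)"
    using avoids_compact_near[OF y nz] U by blast
  have "\<Phi> z \<in> U" if "z \<in> V \<inter> V'" for z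
    using V(3)[of z] V'(3)[of z] that compactin_subset_topspace[OF K] by auto
  then show "\<forall>\<^sub>F z in atin Y y. \<Phi> z \<in> U"
    unfolding eventually_atin using V V' by (blast intro: openin_Int)
qed

lemma tendsto_weight:
  assumes y: "y \<in> topspace Y" and lim: "limitin X \<Phi> (\<Phi> y) (atin Y y)"
  shows "(\<omega> \<longlongrightarrow> \<omega> y) (atin Y y)"
proof -
  obtain f where f: "f \<in> F" "f (\<Phi> y) \<noteq> 0"
    using two_independent_nonzero[OF ind] \<Phi> y by blast
  have "((\<lambda>z. \<omega> z * f (\<Phi> z)) \<longlongrightarrow> \<omega> y * f (\<Phi> y)) (atin Y y)"
    using continuous_map_weighted[OF f(1)] y by (auto simp: continuous_map_atin)
  moreover have *: "((\<lambda>z. f (\<Phi> z)) \<longlongrightarrow> f (\<Phi> y)) (atin Y y)"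
    using continuous_map_limit[OF continuous_map_member[OF f(1)] lim]
    by (simp add: o_def)
  ultimately have "((\<lambda>z. \<omega> z * f (\<Phi> z) / f (\<Phi> z)) \<longlongrightarrow> \<omega> y * f (\<Phi> y) / f (\<Phi> y)) (atin Y y)"
    using f(2) by (intro tendsto_divide)
  \<comment> \<open>Division by zero yields 0, so the cancellation is claimed only near
    \<open>y\<close>, where \<open>f (\<Phi> z)\<close> is nonzero.\<close>
  moreover have "\<forall>\<^sub>F z in atin Y y. \<omega> z * f (\<Phi> z) / f (\<Phi> z) = \<omega> z"
    using tendsto_imp_eventually_ne[OF * f(2)] by eventually_elim simp
  ultimately show ?thesis
    using f(2) by (auto intro: Lim_transform_eventually)
qed

lemma tendsto_weight_zero:
  assumes X: "compact_space X" and y: "y \<in> topspace Y" and z: "\<omega> y = 0"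
  shows "(\<omega> \<longlongrightarrow> 0) (atin Y y)"
  unfolding tendsto_iff dist_norm diff_0_right
proof (intro allI impI)
  fix \<epsilon> :: real assume "\<epsilon> > 0"
  have "\<exists>U V. openin X U \<and> x \<in> U \<and> openin Y V \<and> y \<in> V \<and>
      (\<forall>z \<in> V. \<Phi> z \<in> U \<longrightarrow> norm (\<omega> z) < \<epsilon>)"
    if x: "x \<in> topspace X" for x
  proof -
    obtain f where f: "f \<in> F" "f x \<noteq> 0"
      using two_independent_nonzero[OF ind x] .
    define c where "c = norm (f x) / 2"
    have c: "0 < c" "c < norm (f x)"
      using f by (auto simp: c_def)
    let ?U = "{x \<in> topspace X. norm (of_real c :: 'k) < norm (f x)}"
    let ?V = "{z \<in> topspace Y. norm (\<omega> z * f (\<Phi> z)) < norm (of_real (\<epsilon> * c) :: 'k)}"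
    have "openin X ?U" "openin Y ?V"
      by (intro openin_norm_less continuous_map_member[OF f(1)] continuous_map_weighted[OF f(1)]
        continuous_map_canonical_const)+
    moreover have "x \<in> ?U" "y \<in> ?V"
      using c x y z \<open>\<epsilon> > 0\<close> by auto
    moreover have "norm (\<omega> z) < \<epsilon>" if "z \<in> ?V" "\<Phi> z \<in> ?U" for z
    proof (rule ccontr)
      assume "\<not> norm (\<omega> z) < \<epsilon>"
      \<comment> \<open>On \<open>?U\<close> the norm of \<open>f\<close> exceeds \<open>c\<close>,
        so this contradicts the bound \<open>\<epsilon> * c\<close> defining
        \<open>?V\<close>.\<close>
      then have "\<epsilon> * c \<le> norm (\<omega> z) * norm (f (\<Phi> z))"
        using that c \<open>\<epsilon> > 0\<close> by (intro mult_mono) auto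
      with that c \<open>\<epsilon> > 0\<close> show False
        by (auto simp: norm_mult abs_mult)
    qed
    ultimately show ?thesis
      by blast
  qed
  then obtain V where "openin Y V" "y \<in> V" "\<And>z. z \<in> V \<Longrightarrow> \<Phi> z \<in> topspace X \<Longrightarrow> norm (\<omega> z) < \<epsilon>"
    using X y unfolding compact_space_def
    by (elim compactin_local_property[where P = "\<lambda>z. norm (\<omega> z) < \<epsilon>" and \<Phi> = \<Phi>]) auto
  then show "\<forall>\<^sub>F z in atin Y y. norm (\<omega> z) < \<epsilon>"
    unfolding eventually_atin using \<Phi> openin_subset by blast
qed

lemma maps_into_compact_near:
  assumes F0: "F \<subseteq> cont_funs_0 X" and bdd: "bounded (\<omega> ` topspace Y)"
    and y: "y \<in> topspace Y" and nz: "\<omega> y \<noteq> 0"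
  obtains K V where "compactin X K" "openin Y V" "y \<in> V" "\<And>z. z \<in> V \<Longrightarrow> \<Phi> z \<in> K"
proof -
  obtain f where f: "f \<in> F" "f (\<Phi> y) \<noteq> 0"
    using two_independent_nonzero[OF ind] \<Phi> y by blast
  obtain M where M: "M > 0" "\<And>z. z \<in> topspace Y \<Longrightarrow> norm (\<omega> z) \<le> M"
    using bdd by (auto simp: bounded_pos)
  define c where "c = norm (\<omega> y * f (\<Phi> y)) / 2"
  have c: "0 < c" "c < norm (\<omega> y * f (\<Phi> y))"
    using f nz by (auto simp: c_def)
  then have "c / M > 0"
    using M by simp
  \<comment> \<open>With the threshold \<open>c / M\<close>, a point \<open>z\<close> with
    \<open>\<Phi> z\<close> outside \<open>K\<close> has weighted value of norm at most
    \<open>c\<close>, hence lies outside \<open>?V\<close>.\<close>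
  then obtain K where K: "compactin X K" "\<And>x. x \<in> topspace X - K \<Longrightarrow> norm (f x) < c / M"
    using F0 f(1) unfolding cont_funs_0_def by blast
  let ?V = "{z \<in> topspace Y. norm (of_real c :: 'k) < norm (\<omega> z * f (\<Phi> z))}"
  have "openin Y ?V"
    using f(1) by (intro openin_norm_less continuous_map_weighted continuous_map_canonical_const)
  moreover have "y \<in> ?V"
    using c y by auto
  moreover have "\<Phi> z \<in> K" if "z \<in> ?V" for z
  proof (rule ccontr)
    assume "\<Phi> z \<notin> K"
    then have "norm (f (\<Phi> z)) < c / M"
      using K \<Phi> that by auto
    then have "norm (\<omega> z) * norm (f (\<Phi> z)) \<le> M * (c / M)"
      using M that by (intro mult_mono) auto
    then show False
      using that M c by (simp add: norm_mult)
  qed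
  ultimately show thesis
    using that K(1) by blast
qed

end

theorem theorem3p10:
  fixes X :: "'a topology" and Y :: "'b topology"
    and F :: "('a \<Rightarrow> 'k::real_normed_field) set"
    and \<omega> :: "'b \<Rightarrow> 'k" and \<Phi> :: "'b \<Rightarrow> 'a"
  assumes "locally_compact_space X" and "Hausdorff_space X"
    and "locally_compact_space Y" and "Hausdorff_space Y"
    and "fun_space.subspace F" and "F \<subseteq> cont_funs X"
    and "two_independent X F"
    and "\<Phi> \<in> topspace Y \<rightarrow> topspace X"
    and "weighted_comp \<Phi> \<omega> ` F \<subseteq> cont_funs Y"
  shows "(compact_space X \<longrightarrow>
            continuous_map Y euclidean \<omega> \<and>
            continuous_map (subtopology Y {y \<in> topspace Y. \<omega> y \<noteq> 0}) X \<Phi>) \<and>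
         (F \<subseteq> cont_funs_0 X \<and> bounded (\<omega> ` topspace Y) \<longrightarrow>
            continuous_map (subtopology Y {y \<in> topspace Y. \<omega> y \<noteq> 0}) euclidean \<omega> \<and>
            continuous_map (subtopology Y {y \<in> topspace Y. \<omega> y \<noteq> 0}) X \<Phi>)"
proof (intro conjI impI)
  let ?S = "{y \<in> topspace Y. \<omega> y \<noteq> 0}"
  note ctxt = assms(5-9)
  {
    assume X: "compact_space X"
    have lim: "limitin X \<Phi> (\<Phi> y) (atin Y y)" if "y \<in> ?S" for y
      using X that \<open>\<Phi> \<in> topspace Y \<rightarrow> topspace X\<close> unfolding compact_space_def
      by (intro limitin_composition_map[OF ctxt, where V = "topspace Y"]) auto
    then show "continuous_map (subtopology Y ?S) X \<Phi>"
      by (rule continuous_map_subtopology_limitin)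
    show "continuous_map Y euclidean \<omega>"
      unfolding continuous_map_atin limitin_canonical_iff
    proof
      fix y assume y: "y \<in> topspace Y"
      show "(\<omega> \<longlongrightarrow> \<omega> y) (atin Y y)"
        \<comment> \<open>The limit of \<open>\<Phi>\<close> is available only where
          \<open>\<omega>\<close> is nonzero; zeros of \<open>\<omega>\<close> are handled by
          compactness of \<open>X\<close>.\<close>
        using tendsto_weight[OF ctxt y lim] tendsto_weight_zero[OF ctxt X y] y
        by (cases "\<omega> y = 0") auto
    qed
  }
  {
    assume "F \<subseteq> cont_funs_0 X \<and> bounded (\<omega> ` topspace Y)"
    then have lim: "limitin X \<Phi> (\<Phi> y) (atin Y y)" if "y \<in> ?S" for y
      using that maps_into_compact_near[OF ctxt, of y] limitin_composition_map[OF ctxt, of y]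
      by (metis (mono_tags, lifting) mem_Collect_eq)
    then show "continuous_map (subtopology Y ?S) X \<Phi>"
      by (rule continuous_map_subtopology_limitin)
    show "continuous_map (subtopology Y ?S) euclidean \<omega>"
      using tendsto_weight[OF ctxt _ lim] by (intro continuous_map_subtopology_limitin) auto
  }
qed

end
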